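(* For any fixed integer $k\ge2$ and positive constant $\alpha$, as $n\to\infty$, $$\mathbb{P}\big[\mathbf{C}_{n,p}\text{ has at least }k\text{ equal terms}\big]\to\begin{cases}1,&\text{if } q\gg n^{-k/(k-1)},\\ 1-e^{-\alpha^{k-1}/(k\cdot k!)},&\text{if } q\sim\alpha n^{-k/(k-1)},\\ 0,&\text{if } n^{-k/(k-1)}\gg q.\end{cases}$$
   Context: An $n$-composition is a sequence of $n$ nonnegative integers. For $p=p(n)\in[0,1)$ and $q=1-p$, the geometric random composition $\mathbf{C}_{n,p}$ is the random $n$-composition whose terms are independent, with $\mathbb{P}[\mathbf{C}_{n,p}(i)=j]=qp^j$ for every $j\ge0$ and $i\in\{1,\dots,n\}$. A composition $C$ has at least $k$ equal terms if there are $k$ distinct indices $i_1<\dots<i_k$ (not necessarily consecutive) with $C(i_1)=\dots=C(i_k)$. For positive functions of $n$: $f\ll g$ (or $g\gg f$) means $\lim_{n\to\infty} f/g=0$, and $f\sim g$ means $\lim_{n\to\infty} f/g=1$. *)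

theory Defs
  imports "HOL-Probability.Probability"
begin

text \<open>
  An \<open>n\<close>-composition is represented as a function \<open>nat \<Rightarrow> nat\<close> whose terms are its values on
  the index set \<open>{1..n}\<close>; outside \<open>{1..n}\<close> it takes the dummy value 0.
  The library's \<^const>\<open>geometric_pmf\<close> is parametrised by the success probability, which is \<open>q = 1 - p\<close>.
\<close>
definition geometric_composition :: "nat \<Rightarrow> real \<Rightarrow> (nat \<Rightarrow> nat) pmf" where
  "geometric_composition n p = Pi_pmf {1..n} 0 (\<lambda>_. geometric_pmf (1 - p))"

lemma prob_geometric_composition_term:
  assumes "0 \<le> p" "p < 1" "i \<in> {1..n}"
  shows "measure_pmf.prob (geometric_composition n p) {C. C i = j} = (1 - p) * p ^ j"
proof -
  have "measure_pmf.prob (geometric_composition n p) {C. C i = j} =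
          pmf (map_pmf (\<lambda>C. C i) (geometric_composition n p)) j"
    by (simp add: pmf_map vimage_def)
  also have "map_pmf (\<lambda>C. C i) (geometric_composition n p) = geometric_pmf (1 - p)"
    using assms by (simp add: geometric_composition_def Pi_pmf_component)
  finally show ?thesis
    using assms by simp
qed

lemma indep_vars_geometric_composition:
  "prob_space.indep_vars (measure_pmf (geometric_composition n p))
     (\<lambda>_. count_space UNIV) (\<lambda>i C. C i) {1..n}"
  unfolding geometric_composition_def by (rule indep_vars_Pi_pmf) simp

definition has_equal_terms :: "nat \<Rightarrow> nat \<Rightarrow> (nat \<Rightarrow> nat) \<Rightarrow> bool" where
  "has_equal_terms n k C \<longleftrightarrow> (\<exists>I\<subseteq>{1..n}. card I = k \<and> (\<forall>i\<in>I. \<forall>j\<in>I. C i = C j))"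

definition much_less :: "(nat \<Rightarrow> real) \<Rightarrow> (nat \<Rightarrow> real) \<Rightarrow> bool" where
  "much_less f g \<longleftrightarrow> (\<lambda>n. f n / g n) \<longlonglongrightarrow> 0"

definition asymptotic_to :: "(nat \<Rightarrow> real) \<Rightarrow> (nat \<Rightarrow> real) \<Rightarrow> bool" where
  "asymptotic_to f g \<longleftrightarrow> (\<lambda>n. f n / g n) \<longlonglongrightarrow> 1"

end

theory Submission
  imports Defs
begin

text \<open>
  Write \<open>avoid_prob k q n\<close> for the probability that no value occurs \<open>k\<close> times among \<open>n\<close> independent
  geometric terms. Consider the values 0, 1, 2, ... in turn. By memorylessness, if \<open>n\<close> terms
  have not yet been assigned a value, a binomial number of them take the current one, and the others
  start afresh at the next. So the number of unassigned terms is a decreasing Markov chain, and the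
  composition has \<open>k\<close> equal terms exactly if the chain at some time drops by at least \<open>k\<close>. This gives
  the recursion \<open>avoid_prob_eq_sum_Bernstein\<close>. Discarding the values that no term takes
  (\<open>avoid_prob_recursion\<close>), the probability that a step of the chain from \<open>m\<close> is fatal is the hazard
  rate \<open>binomial_tail q k m / (1 - (1 - q) ^ m)\<close>.

  If \<open>n q\<close> is small, almost every step is a drop by 1, and the hazard rate at \<open>m\<close> is close to
  \<open>(m - 1 choose k - 1) * q ^ (k - 1) / k\<close>. The product of the survival probabilities is therefore
  close to \<open>exp (- (n choose k) * q ^ (k - 1) / k)\<close>. The lemmas
  \<open>exp_coincidence_mean_le_avoid_prob\<close> and \<open>avoid_prob_le_exp_coincidence_mean\<close> make this precise from
  both sides with explicit errors. As the exponent is asymptotic to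
  \<open>n ^ k * q ^ (k - 1) / (k * k!)\<close>, this gives the critical regime, and the subcritical one
  as the case of limit 0 of the exponent (\<open>avoid_prob_tendsto_exp\<close>).

  In the supercritical regime \<open>q\<close> need not tend to 0 and only the order of magnitude of the hazard
  rate matters. A step is fatal if each of \<open>k\<close> blocks of unassigned terms contains one taking
  the current value. Every other step drops by less than \<open>k\<close>, so there are order \<open>n\<close> steps with
  at least a fixed fraction of the terms left. This gives \<open>avoid_prob_le_exp_min\<close>, whose
  exponent diverges as soon as \<open>n ^ k * q ^ (k - 1)\<close> does.
\<close>

section \<open>Conditioning on the set of zero terms\<close>

text \<open>
  The smallest value is treated first: given which terms vanish, the remaining ones, lowered by 1,
  again form a geometric composition. Level sets over an arbitrary finite index set are needed
  because the surviving indices need not form an interval.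
\<close>
definition levels_below :: "nat \<Rightarrow> 'a set \<Rightarrow> ('a \<Rightarrow> nat) \<Rightarrow> bool" where
  "levels_below k A C \<longleftrightarrow> (\<forall>v. card {i\<in>A. C i = v} < k)"

definition avoid_prob_on :: "nat \<Rightarrow> real \<Rightarrow> nat set \<Rightarrow> real" where
  "avoid_prob_on k q A = measure_pmf.prob (Pi_pmf A 0 (\<lambda>_. geometric_pmf q)) {C. levels_below k A C}"

lemma has_equal_terms_iff:
  assumes "k \<ge> 1"
  shows "has_equal_terms n k C \<longleftrightarrow> \<not> levels_below k {1..n} C"
proof
  assume "has_equal_terms n k C"
  then obtain I where I: "I \<subseteq> {1..n}" "card I = k" "\<forall>i\<in>I. \<forall>j\<in>I. C i = C j"
    unfolding has_equal_terms_def by blast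
  from assms I(2) obtain a where "a \<in> I" by fastforce
  with I have "I \<subseteq> {i\<in>{1..n}. C i = C a}" by blast
  then have "k \<le> card {i\<in>{1..n}. C i = C a}"
    unfolding I(2)[symmetric] by (intro card_mono) auto
  then show "\<not> levels_below k {1..n} C"
    unfolding levels_below_def not_all not_less by (rule exI[of _ "C a"])
next
  assume "\<not> levels_below k {1..n} C"
  then obtain v where "k \<le> card {i\<in>{1..n}. C i = v}"
    unfolding levels_below_def not_all not_less by blast
  then obtain I where "I \<subseteq> {i\<in>{1..n}. C i = v}" "card I = k"
    by (rule obtain_subset_with_card_n) blast
  moreover from this have "I \<subseteq> {1..n}" and "\<forall>i\<in>I. \<forall>j\<in>I. C i = C j" by blast+
  ultimately show "has_equal_terms n k C"
    unfolding has_equal_terms_def by (intro exI[of _ I] conjI)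
qed

text \<open>
  The configuration with zero set \<open>Z\<close> is obtained from a configuration on the remaining indices by
  raising every term there by 1. Its level sets are \<open>Z\<close> and the old level sets, renumbered.
\<close>
lemma levels_below_shift:
  assumes Z: "Z \<subseteq> A" and C: "\<forall>i\<in>Z. C i = 0"
  shows "levels_below k A (\<lambda>i. if i \<in> A - Z then Suc (C i) else C i) \<longleftrightarrow>
         card Z < k \<and> levels_below k (A - Z) C"
proof -
  have lev0: "{i\<in>A. (if i \<in> A - Z then Suc (C i) else C i) = 0} = Z"
    using Z C by auto
  have levS: "{i\<in>A. (if i \<in> A - Z then Suc (C i) else C i) = Suc v} = {i\<in>A - Z. C i = v}" for v
    using Z C by auto
  have split: "(\<forall>v. Q v) \<longleftrightarrow> Q 0 \<and> (\<forall>v. Q (Suc v))" for Q :: "nat \<Rightarrow> bool"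
    by (metis nat.exhaust)
  show ?thesis
    unfolding levels_below_def
      split[of "\<lambda>v. card {i\<in>A. (if i \<in> A - Z then Suc (C i) else C i) = v} < k"] lev0 levS
    by (rule refl)
qed

text \<open>
  Memorylessness of the geometric distribution: raising one term by 1 multiplies its probability by
  \<open>1 - q\<close>, so the raising map has the constant Jacobian \<open>(1 - q) ^ card (A - Z)\<close>, and each index
  of \<open>Z\<close> contributes a factor \<open>q\<close>.
\<close>
lemma prob_zero_set:
  assumes q: "0 < q" "q \<le> 1" and fin: "finite A" and Z: "Z \<subseteq> A"
  shows "measure_pmf.prob (Pi_pmf A 0 (\<lambda>_. geometric_pmf q))
            {C. levels_below k A C \<and> {i\<in>A. C i = 0} = Z} =
         (if card Z < k then q ^ card Z * (1 - q) ^ card (A - Z) * avoid_prob_on k q (A - Z) else 0)"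
proof -
  let ?M = "\<lambda>A. Pi_pmf A 0 (\<lambda>_. geometric_pmf q)"
  have finB: "finite (A - Z)" using fin by simp
  define h where "h = (\<lambda>(C::nat \<Rightarrow> nat) i. if i \<in> A - Z then Suc (C i) else C i)"
  define S where "S = {C. (\<forall>i\<in>Z. C i = 0) \<and> card Z < k \<and> levels_below k (A - Z) C}"
  have inj: "inj_on h S"
    unfolding h_def by (intro inj_onI ext) (metis nat.inject)
  have img: "{C. levels_below k A C \<and> {i\<in>A. C i = 0} = Z} = h ` S"
  proof (intro equalityI subsetI)
    fix C assume "C \<in> {C. levels_below k A C \<and> {i\<in>A. C i = 0} = Z}"
    then have C: "levels_below k A C" "{i\<in>A. C i = 0} = Z" by auto
    define D where "D = (\<lambda>i. if i \<in> A - Z then C i - 1 else C i)"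
    have hD: "h D = C" using C(2) by (auto simp: h_def D_def)
    have D0: "\<forall>i\<in>Z. D i = 0" using C(2) by (auto simp: D_def)
    have "levels_below k A (h D) \<longleftrightarrow> card Z < k \<and> levels_below k (A - Z) D"
      unfolding h_def by (rule levels_below_shift[OF Z D0])
    then have "D \<in> S" using C(1) hD D0 by (simp add: S_def)
    then show "C \<in> h ` S" using hD by blast
  next
    fix C assume "C \<in> h ` S"
    then obtain D where D: "D \<in> S" "C = h D" by blast
    then have D0: "\<forall>i\<in>Z. D i = 0" by (simp add: S_def)
    have "levels_below k A (h D) \<longleftrightarrow> card Z < k \<and> levels_below k (A - Z) D"
      unfolding h_def by (rule levels_below_shift[OF Z D0])
    moreover have "{i\<in>A. h D i = 0} = Z" using D0 Z by (auto simp: h_def)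
    moreover have "card Z < k \<and> levels_below k (A - Z) D" using D(1) by (simp add: S_def)
    ultimately show "C \<in> {C. levels_below k A C \<and> {i\<in>A. C i = 0} = Z}"
      unfolding D(2) mem_Collect_eq by (intro conjI) simp_all
  qed
  have pmf_h: "pmf (?M A) (h C) = q ^ card Z * (1 - q) ^ card (A - Z) * pmf (?M (A - Z)) C"
    if "C \<in> S" for C
  proof (cases "\<forall>i. i \<notin> A \<longrightarrow> C i = 0")
    case True
    have C0: "\<forall>i\<in>Z. C i = 0" using that by (simp add: S_def)
    have "pmf (?M A) (h C) = (\<Prod>i\<in>A. pmf (geometric_pmf q) (h C i))"
      using fin True by (intro pmf_Pi') (auto simp: h_def)
    also have "\<dots> = (\<Prod>i\<in>Z. pmf (geometric_pmf q) (h C i)) * (\<Prod>i\<in>A - Z. pmf (geometric_pmf q) (h C i))"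
      using fin Z by (metis mult.commute prod.subset_diff)
    also have "(\<Prod>i\<in>Z. pmf (geometric_pmf q) (h C i)) = q ^ card Z"
      using C0 q by (simp add: h_def)
    also have "(\<Prod>i\<in>A - Z. pmf (geometric_pmf q) (h C i)) =
        (1 - q) ^ card (A - Z) * (\<Prod>i\<in>A - Z. pmf (geometric_pmf q) (C i))"
      using q by (simp add: h_def prod.distrib[symmetric] mult_ac flip: prod_constant)
    also have "(\<Prod>i\<in>A - Z. pmf (geometric_pmf q) (C i)) = pmf (?M (A - Z)) C"
      using finB True C0 by (intro pmf_Pi'[symmetric]) auto
    finally show ?thesis by (simp add: mult_ac)
  next
    case False
    then have "pmf (?M A) (h C) = 0"
      by (intro pmf_Pi_outside fin) (auto simp: h_def)
    moreover from False have "pmf (?M (A - Z)) C = 0"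
      by (intro pmf_Pi_outside finB) auto
    ultimately show ?thesis by simp
  qed
  have "measure_pmf.prob (?M A) (h ` S) = infsetsum (pmf (?M A)) (h ` S)"
    by (rule measure_pmf_conv_infsetsum)
  also have "\<dots> = infsetsum (\<lambda>C. pmf (?M A) (h C)) S"
    by (rule infsetsum_reindex[OF inj])
  also have "\<dots> = infsetsum (\<lambda>C. q ^ card Z * (1 - q) ^ card (A - Z) * pmf (?M (A - Z)) C) S"
    by (intro infsetsum_cong pmf_h refl)
  also have "\<dots> = q ^ card Z * (1 - q) ^ card (A - Z) * measure_pmf.prob (?M (A - Z)) S"
    by (subst measure_pmf_conv_infsetsum) (intro infsetsum_cmult_right pmf_abs_summable)
  also have "measure_pmf.prob (?M (A - Z)) S = (if card Z < k then avoid_prob_on k q (A - Z) else 0)"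
  proof (cases "card Z < k")
    case True
    have "set_pmf (?M (A - Z)) \<subseteq> {C. \<forall>i. i \<notin> A - Z \<longrightarrow> C i = 0}"
      by (rule set_Pi_pmf_subset[OF finB])
    then have "measure_pmf.prob (?M (A - Z)) S = avoid_prob_on k q (A - Z)"
      unfolding avoid_prob_on_def S_def using True
      by (intro measure_prob_cong_0) (auto simp: set_pmf_iff subset_iff)
    with True show ?thesis by simp
  next
    case False
    then have "S = {}" by (auto simp: S_def)
    with False show ?thesis by simp
  qed
  finally show ?thesis by (simp add: img)
qed

lemma avoid_prob_on_eq_sum_zero_sets:
  assumes q: "0 < q" "q \<le> 1" and fin: "finite A"
  shows "avoid_prob_on k q A =
     (\<Sum>Z\<in>{Z. Z \<subseteq> A \<and> card Z < k}. q ^ card Z * (1 - q) ^ card (A - Z) * avoid_prob_on k q (A - Z))"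
proof -
  let ?M = "measure_pmf.prob (Pi_pmf A 0 (\<lambda>_. geometric_pmf q))"
  define E where "E Z = {C. levels_below k A C \<and> {i\<in>A. C i = 0} = Z}" for Z
  have cover: "{C. levels_below k A C} = (\<Union>Z\<in>Pow A. E Z)"
  proof (intro equalityI subsetI)
    fix C assume "C \<in> {C. levels_below k A C}"
    then have "C \<in> E {i\<in>A. C i = 0}" by (simp add: E_def)
    then show "C \<in> (\<Union>Z\<in>Pow A. E Z)" by (rule UN_I[rotated]) simp
  qed (simp add: E_def)
  have zeros: "{i\<in>A. C i = 0} = Z" if "C \<in> E Z" for C Z
    using that by (simp add: E_def)
  have "disjoint_family_on E (Pow A)"
    unfolding disjoint_family_on_def
  proof (intro ballI impI equals0I)
    fix Y Z C assume "Y \<noteq> Z" "C \<in> E Y \<inter> E Z"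
    then show False using zeros[of C Y] zeros[of C Z] by (elim IntE) simp
  qed
  then have "avoid_prob_on k q A = (\<Sum>Z\<in>Pow A. ?M (E Z))"
    unfolding avoid_prob_on_def cover using fin
    by (intro measure_pmf.finite_measure_finite_Union) (simp_all only: finite_Pow_iff sets_measure_pmf UNIV_I subset_UNIV)
  also have "\<dots> = (\<Sum>Z\<in>Pow A. if card Z < k then
      q ^ card Z * (1 - q) ^ card (A - Z) * avoid_prob_on k q (A - Z) else 0)"
    unfolding E_def by (intro sum.cong refl prob_zero_set[OF q fin] PowD)
  also have "\<dots> = (\<Sum>Z\<in>{Z. Z \<subseteq> A \<and> card Z < k}.
      q ^ card Z * (1 - q) ^ card (A - Z) * avoid_prob_on k q (A - Z))"
    using fin by (simp add: sum.If_cases Int_def)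
  finally show ?thesis .
qed

lemma avoid_prob_on_card_cong:
  assumes "finite A" "finite B" "card A = card B"
  shows "avoid_prob_on k q A = avoid_prob_on k q B"
proof -
  obtain h where h: "bij_betw h A B" using finite_same_card_bij[OF assms] by blast
  obtain y where y: "y \<notin> B" using ex_new_if_finite[OF infinite_UNIV_nat \<open>finite B\<close>] by blast
  \<comment> \<open>\<open>Pi_pmf_bij_betw\<close> asks that no index outside \<open>A\<close> be sent into \<open>B\<close>.\<close>
  define g where "g = (\<lambda>x. if x \<in> A then h x else y)"
  have g: "bij_betw g A B" using h by (simp add: g_def cong: bij_betw_cong)
  have "{i\<in>B. C i = v} = g ` {i\<in>A. C (g i) = v}" for C :: "nat \<Rightarrow> nat" and v
    using g unfolding bij_betw_def by blast
  moreover have "inj_on g {i\<in>A. C (g i) = v}" for C :: "nat \<Rightarrow> nat" and v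
    using g unfolding bij_betw_def by (auto intro: inj_on_subset)
  ultimately have "card {i\<in>A. C (g i) = v} = card {i\<in>B. C i = v}" for C :: "nat \<Rightarrow> nat" and v
    by (simp add: card_image)
  then have "levels_below k A (C \<circ> g) \<longleftrightarrow> levels_below k B C" for C
    unfolding levels_below_def o_def by simp
  then show ?thesis
    unfolding avoid_prob_on_def using y
    by (subst Pi_pmf_bij_betw[OF \<open>finite A\<close> g]) (auto simp: g_def vimage_def)
qed

text \<open>
  The marginal of the random composition on a subset of indices is the random composition on that
  subset, and deleting indices only shrinks level sets.
\<close>
lemma avoid_prob_on_antimono:
  assumes fin: "finite A" and B: "B \<subseteq> A"
  shows "avoid_prob_on k q A \<le> avoid_prob_on k q B"
proof -
  let ?M = "Pi_pmf A 0 (\<lambda>_. geometric_pmf q)"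
  have sub: "{i\<in>B. (if i \<in> B then C i else 0) = v} \<subseteq> {i\<in>A. C i = v}" for C :: "nat \<Rightarrow> nat" and v
    using B by auto
  have "levels_below k B (\<lambda>i. if i \<in> B then C i else 0)" if "levels_below k A C" for C
    unfolding levels_below_def
  proof
    fix v
    have "card {i\<in>B. (if i \<in> B then C i else 0) = v} \<le> card {i\<in>A. C i = v}"
      using fin by (intro card_mono sub) auto
    also have "\<dots> < k" using that by (simp add: levels_below_def)
    finally show "card {i\<in>B. (if i \<in> B then C i else 0) = v} < k" .
  qed
  then have "measure_pmf.prob ?M {C. levels_below k A C} \<le>
        measure_pmf.prob ?M {C. levels_below k B (\<lambda>i. if i \<in> B then C i else 0)}"
    by (intro measure_pmf.finite_measure_mono) auto
  also have "\<dots> = avoid_prob_on k q B"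
    unfolding avoid_prob_on_def by (subst Pi_pmf_subset[OF fin B]) (simp add: vimage_def)
  finally show ?thesis by (simp add: avoid_prob_on_def)
qed

section \<open>Dependence on the number of terms\<close>

definition avoid_prob :: "nat \<Rightarrow> real \<Rightarrow> nat \<Rightarrow> real" where
  "avoid_prob k q n = avoid_prob_on k q {1..n}"

lemma avoid_prob_nonneg: "0 \<le> avoid_prob k q n" and avoid_prob_le_1: "avoid_prob k q n \<le> 1"
  by (simp_all add: avoid_prob_def avoid_prob_on_def)

lemma avoid_prob_0: "k \<ge> 1 \<Longrightarrow> avoid_prob k q 0 = 1"
  by (simp add: avoid_prob_def avoid_prob_on_def levels_below_def)

lemma avoid_prob_antimono: "m \<le> n \<Longrightarrow> avoid_prob k q n \<le> avoid_prob k q m"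
  unfolding avoid_prob_def by (rule avoid_prob_on_antimono) auto

text \<open>
  The number of zeros is binomially distributed, with weights given by the Bernstein polynomials;
  by exchangeability only the number of the remaining indices matters.
\<close>
lemma avoid_prob_eq_sum_Bernstein:
  assumes q: "0 < q" "q \<le> 1"
  shows "avoid_prob k q n = (\<Sum>i<k. Bernstein n i q * avoid_prob k q (n - i))"
proof -
  define S where "S = {Z. Z \<subseteq> {1..n} \<and> card Z < k}"
  define g where "g i = q ^ i * (1 - q) ^ (n - i) * avoid_prob k q (n - i)" for i
  have fin: "finite S" unfolding S_def by (rule finite_subset[of _ "Pow {1..n}"]) auto
  have term_eq: "q ^ card Z * (1 - q) ^ card ({1..n} - Z) * avoid_prob_on k q ({1..n} - Z) = g (card Z)"
    if "Z \<in> S" for Z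
  proof -
    have Z: "Z \<subseteq> {1..n}" using that by (simp add: S_def)
    then have c: "card ({1..n} - Z) = n - card Z"
      by (simp add: card_Diff_subset finite_subset[OF Z])
    have "avoid_prob_on k q ({1..n} - Z) = avoid_prob k q (n - card Z)"
      unfolding avoid_prob_def using c by (intro avoid_prob_on_card_cong) auto
    with c show ?thesis by (simp add: g_def)
  qed
  have "avoid_prob k q n = (\<Sum>Z\<in>S. g (card Z))"
    unfolding avoid_prob_def avoid_prob_on_eq_sum_zero_sets[OF q finite_atLeastAtMost] S_def[symmetric]
    by (intro sum.cong refl term_eq)
  also have "\<dots> = (\<Sum>i<k. \<Sum>Z\<in>{Z\<in>S. card Z = i}. g (card Z))"
    using fin by (intro sum.group[symmetric]) (auto simp: S_def)
  also have "\<dots> = (\<Sum>i<k. Bernstein n i q * avoid_prob k q (n - i))"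
  proof (intro sum.cong refl)
    fix i assume i: "i \<in> {..<k}"
    have "{Z\<in>S. card Z = i} = {Z. Z \<subseteq> {1..n} \<and> card Z = i}"
      using i by (auto simp: S_def)
    then have "card {Z\<in>S. card Z = i} = n choose i"
      using n_subsets[of "{1..n}" i] by simp
    then show "(\<Sum>Z\<in>{Z\<in>S. card Z = i}. g (card Z)) = Bernstein n i q * avoid_prob k q (n - i)"
      by (simp add: g_def Bernstein_def)
  qed
  finally show ?thesis .
qed

section \<open>Tails of the binomial distribution\<close>

text \<open>
  The probability of at least \<open>j\<close> successes in \<open>n\<close> trials. Writing it through the complementary sum
  matches the range of summation in the recursion for \<open>avoid_prob\<close>.
\<close>
definition binomial_tail :: "real \<Rightarrow> nat \<Rightarrow> nat \<Rightarrow> real" where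
  "binomial_tail q j n = 1 - (\<Sum>i<j. Bernstein n i q)"

lemma Bernstein_Suc_0: "Bernstein (Suc n) 0 q = (1 - q) * Bernstein n 0 q"
  by (simp add: Bernstein_def)

lemma Bernstein_Suc_Suc:
  "Bernstein (Suc n) (Suc i) q = q * Bernstein n i q + (1 - q) * Bernstein n (Suc i) q"
proof (cases "i < n")
  case True
  then have "n - i = Suc (n - Suc i)" by simp
  then show ?thesis by (simp add: Bernstein_def algebra_simps)
next
  case False
  then show ?thesis by (simp add: Bernstein_def binomial_eq_0 algebra_simps)
qed

lemma binomial_tail_0 [simp]: "binomial_tail q 0 n = 1"
  by (simp add: binomial_tail_def)

lemma binomial_tail_Suc_0 [simp]: "binomial_tail q (Suc j) 0 = 0"
  by (simp add: binomial_tail_def sum.lessThan_Suc_shift Bernstein_def del: sum.lessThan_Suc)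

text \<open>
  Conditioning on the last trial gives the recursion on which the inductions below rest.
\<close>
lemma binomial_tail_Suc_Suc:
  "binomial_tail q (Suc j) (Suc n) = q * binomial_tail q j n + (1 - q) * binomial_tail q (Suc j) n"
proof -
  have "(\<Sum>i<Suc j. Bernstein (Suc n) i q) =
        q * (\<Sum>i<j. Bernstein n i q) + (1 - q) * (\<Sum>i<Suc j. Bernstein n i q)"
    unfolding sum.lessThan_Suc_shift Bernstein_Suc_0 Bernstein_Suc_Suc
    by (simp add: sum.distrib sum_distrib_left distrib_left)
  then show ?thesis unfolding binomial_tail_def by (simp add: algebra_simps)
qed

lemma binomial_tail_one: "binomial_tail q (Suc 0) n = 1 - (1 - q) ^ n"
  by (simp add: binomial_tail_def Bernstein_def)

context
  fixes q :: real
  assumes q: "0 < q" "q \<le> 1"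
begin

lemma binomial_tail_nonneg: "0 \<le> binomial_tail q j n"
proof (induction n arbitrary: j)
  case 0
  show ?case by (cases j) auto
next
  case (Suc n)
  show ?case using q Suc by (cases j) (auto simp: binomial_tail_Suc_Suc)
qed

lemma binomial_tail_Suc_le: "binomial_tail q (Suc j) n \<le> binomial_tail q j n"
  using q by (simp add: binomial_tail_def Bernstein_nonneg)

lemma Bernstein_le_binomial_tail: "Bernstein n j q \<le> binomial_tail q j n"
  using binomial_tail_nonneg[of "Suc j" n] by (simp add: binomial_tail_def)

lemma binomial_tail_mono: "m \<le> n \<Longrightarrow> binomial_tail q j m \<le> binomial_tail q j n"
proof (induction n rule: dec_induct)
  case (step n)
  have "binomial_tail q j n \<le> binomial_tail q j (Suc n)"
  proof (cases j)
    case (Suc i)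
    have "q * (binomial_tail q i n - binomial_tail q (Suc i) n) \<ge> 0"
      using q binomial_tail_Suc_le[of i n] by simp
    then show ?thesis unfolding Suc binomial_tail_Suc_Suc by (simp add: algebra_simps)
  qed simp
  with step show ?case by linarith
qed simp

text \<open>
  The union bound over the sets of \<open>j\<close> trials that could all succeed.
\<close>
lemma binomial_tail_le: "binomial_tail q j n \<le> real (n choose j) * q ^ j"
proof (induction n arbitrary: j)
  case 0
  show ?case by (cases j) auto
next
  case (Suc n)
  show ?case
  proof (cases j)
    case (Suc i)
    have "q * binomial_tail q i n \<le> q * (real (n choose i) * q ^ i)"
      using q Suc.IH[of i] by simp
    moreover have "(1 - q) * binomial_tail q (Suc i) n \<le> 1 * (real (n choose Suc i) * q ^ Suc i)"
      using q Suc.IH[of "Suc i"] binomial_tail_nonneg[of "Suc i" n] by (intro mult_mono) auto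
    ultimately show ?thesis unfolding Suc binomial_tail_Suc_Suc by (simp add: algebra_simps)
  qed simp
qed

text \<open>
  One way to have \<open>j + 1\<close> successes is to have \<open>j\<close> in the first \<open>m\<close> trials and one more afterwards.
\<close>
lemma binomial_tail_add:
  "binomial_tail q j m * binomial_tail q 1 s \<le> binomial_tail q (Suc j) (m + s)"
proof (induction s)
  case 0
  show ?case by (simp add: binomial_tail_nonneg)
next
  case (Suc s)
  have "binomial_tail q j m * binomial_tail q 1 (Suc s) =
      q * binomial_tail q j m + (1 - q) * (binomial_tail q j m * binomial_tail q 1 s)"
    by (simp add: binomial_tail_Suc_Suc algebra_simps)
  also have "\<dots> \<le> q * binomial_tail q j (m + s) + (1 - q) * binomial_tail q (Suc j) (m + s)"
    using q Suc binomial_tail_mono[of m "m + s" j] by (intro add_mono mult_left_mono) auto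
  also have "\<dots> = binomial_tail q (Suc j) (m + Suc s)"
    by (simp add: binomial_tail_Suc_Suc)
  finally show ?case .
qed

text \<open>
  It suffices that each of \<open>j\<close> disjoint blocks of \<open>s\<close> trials contains a success. Unlike the leading
  binomial term, this bound stays useful when \<open>n * q\<close> is large.
\<close>
lemma binomial_tail_blocks: "binomial_tail q 1 s ^ j \<le> binomial_tail q j (j * s)"
proof (induction j)
  case (Suc j)
  have "binomial_tail q 1 s ^ Suc j \<le> binomial_tail q j (j * s) * binomial_tail q 1 s"
    unfolding power_Suc2 by (intro mult_right_mono Suc binomial_tail_nonneg)
  also have "\<dots> \<le> binomial_tail q (Suc j) (Suc j * s)"
    using binomial_tail_add[of j "j * s" s] by (simp add: add.commute)
  finally show ?case .
qed simp

text \<open>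
  This is Bernoulli's inequality for \<open>(1 + q) ^ n\<close> combined with \<open>1 - q \<le> 1 / (1 + q)\<close>. The bound has
  the right order both for small and for large \<open>n * q\<close>.
\<close>
lemma binomial_tail_one_ge: "real n * q / (1 + real n * q) \<le> 1 - (1 - q) ^ n"
proof -
  have "(1 - q) ^ n * (1 + real n * q) \<le> (1 - q) ^ n * (1 + q) ^ n"
    using q Bernoulli_inequality[of q n] by (intro mult_left_mono) auto
  also have "\<dots> = (1 - q\<^sup>2) ^ n"
    by (simp add: power_mult_distrib[symmetric] power2_eq_square algebra_simps)
  also have "\<dots> \<le> 1"
    using q by (intro power_le_one) (auto simp: power_le_one)
  finally have "(1 - q) ^ n * (1 + real n * q) \<le> 1" .
  moreover have "1 + real n * q > 0" using q by (simp add: add_pos_nonneg)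
  ultimately show ?thesis by (simp add: field_simps)
qed

lemma one_minus_power_pos: "n \<ge> 1 \<Longrightarrow> 0 < 1 - (1 - q) ^ n"
  using q power_strict_decreasing[of 0 n "1 - q"] by (cases "q = 1") (auto simp: power_0_left)

section \<open>Descent in the number of terms\<close>

text \<open>
  The term \<open>i = 0\<close> of the previous sum contains the left-hand side again. Moving it over means
  skipping the empty levels, that is, conditioning on at least one zero.
\<close>
lemma avoid_prob_recursion:
  assumes k: "k \<ge> 1"
  shows "(1 - (1 - q) ^ n) * avoid_prob k q n = (\<Sum>i\<in>{1..<k}. Bernstein n i q * avoid_prob k q (n - i))"
proof -
  have "{..<k} = insert 0 {1..<k}" using k by auto
  then have "avoid_prob k q n = (1 - q) ^ n * avoid_prob k q n + (\<Sum>i\<in>{1..<k}. Bernstein n i q * avoid_prob k q (n - i))"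
    by (subst avoid_prob_eq_sum_Bernstein[OF q]) (simp add: Bernstein_def)
  then show ?thesis by (simp add: algebra_simps)
qed

text \<open>
  Together with the recursion this exhibits \<open>binomial_tail q k n / (1 - (1 - q) ^ n)\<close> as the hazard
  rate: the probability that a nonempty level already holds \<open>k\<close> of the \<open>n\<close> remaining terms.
\<close>
lemma sum_Bernstein_pos:
  assumes k: "k \<ge> 1"
  shows "(\<Sum>i\<in>{1..<k}. Bernstein n i q) = 1 - (1 - q) ^ n - binomial_tail q k n"
proof -
  have "{..<k} = insert 0 {1..<k}" using k by auto
  then show ?thesis by (simp add: binomial_tail_def Bernstein_def)
qed

lemma sum_index_Bernstein_le: "(\<Sum>i\<in>{1..<k}. real i * Bernstein n i q) \<le> real n * q"
proof -
  have "(\<Sum>i\<in>{1..<k}. real i * Bernstein n i q) = (\<Sum>i\<in>{1..<k} \<inter> {..n}. real i * Bernstein n i q)"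
    by (intro sum.mono_neutral_right) (auto simp: Bernstein_def)
  also have "\<dots> \<le> (\<Sum>i\<le>n. real i * Bernstein n i q)"
    using q by (intro sum_mono2) (auto simp: Bernstein_nonneg)
  finally show ?thesis by (simp add: sum_k_Bernstein)
qed

text \<open>
  A nonempty level that is not fatal removes at least one term, and by monotonicity fewer terms are
  easier to keep apart.
\<close>
lemma avoid_prob_ge_previous:
  assumes k: "k \<ge> 1"
  shows "(1 - (1 - q) ^ n - binomial_tail q k n) * avoid_prob k q (n - 1) \<le> (1 - (1 - q) ^ n) * avoid_prob k q n"
  unfolding avoid_prob_recursion[OF k] sum_Bernstein_pos[OF k, symmetric] sum_distrib_right
  using q by (intro sum_mono mult_left_mono avoid_prob_antimono) (auto simp: Bernstein_nonneg)

text \<open>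
  A nonempty level that is not fatal removes fewer than \<open>k\<close> terms.
\<close>
lemma avoid_prob_le_earlier:
  assumes k: "k \<ge> 1"
  shows "(1 - (1 - q) ^ n) * avoid_prob k q n \<le> (1 - (1 - q) ^ n - binomial_tail q k n) * avoid_prob k q (n - k)"
  unfolding avoid_prob_recursion[OF k] sum_Bernstein_pos[OF k, symmetric] sum_distrib_right
  using q by (intro sum_mono mult_left_mono avoid_prob_antimono) (auto simp: Bernstein_nonneg)

end

section \<open>Bounds when few terms coincide\<close>

text \<open>
  To leading order for small \<open>q\<close>, this is the expected number of sets of \<open>k = r + 1\<close> indices with
  equal terms. The exact value has \<open>q ^ k / (1 - (1 - q) ^ k)\<close> in place of \<open>q ^ (k - 1) / k\<close>.
\<close>
definition coincidence_mean :: "nat \<Rightarrow> real \<Rightarrow> nat \<Rightarrow> real" where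
  "coincidence_mean r q n = real (n choose Suc r) * q ^ r / real (Suc r)"

text \<open>
  The increments of \<open>coincidence_mean\<close>. For small \<open>n * q\<close> they approximate the hazard rate.
\<close>
definition coincidence_rate :: "nat \<Rightarrow> real \<Rightarrow> nat \<Rightarrow> real" where
  "coincidence_rate r q n = real ((n - 1) choose r) * q ^ r / real (Suc r)"

lemma coincidence_mean_0 [simp]: "coincidence_mean r q 0 = 0"
  by (simp add: coincidence_mean_def)

lemma coincidence_mean_Suc: "coincidence_mean r q (Suc n) = coincidence_mean r q n + coincidence_rate r q (Suc n)"
  by (simp add: coincidence_mean_def coincidence_rate_def add_divide_distrib distrib_right)

text \<open>
  The form in which the binomial weight of \<open>k\<close> zeros is compared with the probability, about
  \<open>n * q\<close>, of at least one zero.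
\<close>
lemma choose_eq_coincidence_rate:
  assumes "n \<ge> 1"
  shows "real (n choose Suc r) * q ^ Suc r = real n * q * coincidence_rate r q n"
proof -
  obtain m where m: "n = Suc m" using assms by (cases n) auto
  have "real (Suc r) * real (n choose Suc r) = real n * real (m choose r)"
    unfolding m of_nat_mult[symmetric] by (metis Suc_times_binomial)
  then have "real (n choose Suc r) = real n * real (m choose r) / real (Suc r)"
    by (simp add: field_simps)
  then show ?thesis by (simp add: coincidence_rate_def m)
qed

lemma coincidence_rate_nonneg: "0 \<le> q \<Longrightarrow> 0 \<le> coincidence_rate r q n"
  by (simp add: coincidence_rate_def)

lemma coincidence_rate_mono: "0 \<le> q \<Longrightarrow> m \<le> n \<Longrightarrow> coincidence_rate r q m \<le> coincidence_rate r q n"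
  unfolding coincidence_rate_def using binomial_right_mono[of "m - 1" "n - 1" r]
  by (intro divide_right_mono mult_right_mono) auto

lemma coincidence_rate_le:
  assumes "0 \<le> q" "n \<le> N"
  shows "coincidence_rate r q n \<le> (real N * q) ^ r"
proof -
  have "(n - 1) choose r \<le> N ^ r"
  proof (cases "r \<le> n - 1")
    case True
    then have "(n - 1) choose r \<le> (n - 1) ^ r" by (rule binomial_le_pow)
    also have "\<dots> \<le> N ^ r" using assms by (intro power_mono) auto
    finally show ?thesis .
  qed (simp add: binomial_eq_0)
  then have "real ((n - 1) choose r) \<le> real N ^ r"
    by (metis of_nat_le_iff of_nat_power)
  then have "real ((n - 1) choose r) * q ^ r \<le> real N ^ r * q ^ r"
    using assms by (intro mult_right_mono) auto
  moreover have "coincidence_rate r q n \<le> real ((n - 1) choose r) * q ^ r"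
    unfolding coincidence_rate_def using divide_left_mono[of 1 "real (Suc r)" "real ((n - 1) choose r) * q ^ r"] assms
    by simp
  ultimately show ?thesis by (simp add: power_mult_distrib)
qed

lemma coincidence_mean_diff_le:
  assumes "0 \<le> q"
  shows "coincidence_mean r q n - coincidence_mean r q (n - i) \<le> real i * coincidence_rate r q n"
proof (induction i)
  case (Suc i)
  show ?case
  proof (cases "n - i")
    case 0
    then have "n - Suc i = n - i" by simp
    then show ?thesis using Suc coincidence_rate_nonneg[OF assms, of r n] by (simp add: algebra_simps)
  next
    case (Suc l)
    then have l: "n - Suc i = l" by simp
    have "coincidence_rate r q (Suc l) \<le> coincidence_rate r q n" using Suc assms by (intro coincidence_rate_mono) auto
    then show ?thesis using Suc.IH unfolding Suc l coincidence_mean_Suc by (simp add: algebra_simps)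
  qed
qed simp

context
  fixes q :: real
  assumes q: "0 < q" "q \<le> 1"
begin

text \<open>
  The hazard rate with \<open>m\<close> terms left is at most \<open>x = (1 + N q) * coincidence_rate r q m\<close>, by the
  union bound for the tail and the Bernoulli bound for the probability of a nonempty level. Hence
  the avoidance probability loses at most a factor \<open>1 - x \<ge> exp (- x / (1 - \<epsilon>))\<close> per term, and the
  rates add up to \<open>coincidence_mean\<close>.
\<close>
lemma exp_coincidence_mean_le_avoid_prob:
  assumes eps: "(real N * q) ^ r * (1 + real N * q) \<le> \<epsilon>" "\<epsilon> < 1" and "m \<le> N"
  shows "exp (- ((1 + real N * q) / (1 - \<epsilon>) * coincidence_mean r q m)) \<le> avoid_prob (Suc r) q m"
  using \<open>m \<le> N\<close>
proof (induction m)
  case 0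
  show ?case by (simp add: avoid_prob_0)
next
  case (Suc l)
  define m where "m = Suc l"
  define D where "D = 1 - (1 - q) ^ m"
  define x where "x = (1 + real N * q) * coincidence_rate r q m"
  have m: "m \<ge> 1" "m \<le> N" using Suc.prems by (auto simp: m_def)
  have D: "D > 0" unfolding D_def using q m by (intro one_minus_power_pos)
  have mN: "real m * q \<le> real N * q" using q m by simp
  have mq: "0 \<le> real m * q" using q by simp
  have x0: "0 \<le> x" using q by (simp add: x_def coincidence_rate_nonneg)
  have "x \<le> (1 + real N * q) * (real N * q) ^ r"
    unfolding x_def using q m by (intro mult_left_mono coincidence_rate_le) auto
  with eps have x1: "x \<le> \<epsilon>" by (simp add: mult.commute)
  have "real m * q \<le> D * (1 + real m * q)"
    using binomial_tail_one_ge[OF q, of m] mq by (simp add: D_def pos_divide_le_eq add_pos_nonneg)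
  also have "\<dots> \<le> D * (1 + real N * q)"
    using D mN by (intro mult_left_mono) auto
  finally have "real m * q * coincidence_rate r q m \<le> D * (1 + real N * q) * coincidence_rate r q m"
    using q by (intro mult_right_mono coincidence_rate_nonneg) auto
  then have "binomial_tail q (Suc r) m \<le> D * x"
    using binomial_tail_le[OF q, of "Suc r" m] choose_eq_coincidence_rate[OF m(1), of r q]
    by (simp only: x_def mult.assoc)
  then have "(D - D * x) * avoid_prob (Suc r) q l \<le> (D - binomial_tail q (Suc r) m) * avoid_prob (Suc r) q l"
    by (intro mult_right_mono avoid_prob_nonneg) simp
  also have "\<dots> \<le> D * avoid_prob (Suc r) q m"
    using avoid_prob_ge_previous[OF q, of "Suc r" m] by (simp add: D_def m_def)
  finally have "D * ((1 - x) * avoid_prob (Suc r) q l) \<le> D * avoid_prob (Suc r) q m"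
    by (simp add: algebra_simps)
  then have step: "(1 - x) * avoid_prob (Suc r) q l \<le> avoid_prob (Suc r) q m"
    using D by simp
  have "exp (- (x / (1 - \<epsilon>))) \<le> 1 - x"
  proof -
    have "x / (1 - x) \<le> x / (1 - \<epsilon>)"
      using x0 x1 eps by (intro divide_left_mono) auto
    then have "1 + x / (1 - x) \<le> exp (x / (1 - \<epsilon>))"
      using exp_ge_add_one_self[of "x / (1 - \<epsilon>)"] by linarith
    moreover have "1 + x / (1 - x) = inverse (1 - x)"
      using x1 eps by (simp add: field_simps)
    ultimately have "inverse (exp (x / (1 - \<epsilon>))) \<le> 1 - x"
      using x1 eps le_imp_inverse_le[of "inverse (1 - x)" "exp (x / (1 - \<epsilon>))"] by simp
    then show ?thesis by (simp add: exp_minus)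
  qed
  moreover have "(1 + real N * q) / (1 - \<epsilon>) * coincidence_mean r q m =
      (1 + real N * q) / (1 - \<epsilon>) * coincidence_mean r q l + x / (1 - \<epsilon>)"
    by (simp add: m_def coincidence_mean_Suc x_def distrib_left)
  ultimately have "exp (- ((1 + real N * q) / (1 - \<epsilon>) * coincidence_mean r q m)) \<le>
      (1 - x) * exp (- ((1 + real N * q) / (1 - \<epsilon>) * coincidence_mean r q l))"
    by (simp add: exp_add exp_diff exp_minus field_simps)
  also have "\<dots> \<le> (1 - x) * avoid_prob (Suc r) q l"
    using Suc x1 eps by (intro mult_left_mono) auto
  finally show ?case using step by (simp add: m_def)
qed

text \<open>
  The exponential bound is propagated through the recursion. A nonempty level with \<open>i\<close> zeros
  skips \<open>i\<close> increments of \<open>coincidence_mean\<close> at once, which costs about \<open>i * x\<close> for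
  \<open>x = c * coincidence_rate r q m\<close>. Since the mean number of zeros is \<open>m * q\<close>, the total cost is at
  most \<open>m * q * x * exp \<delta>\<close>, and it has to be paid for by the binomial weight of exactly \<open>k\<close> zeros.
  The constant \<open>c\<close> is chosen so that this balance closes; it tends to 1 when \<open>N * q\<close> tends to 0
  and \<open>r \<ge> 1\<close>.
\<close>
lemma avoid_prob_le_exp_coincidence_mean:
  assumes "m \<le> N"
  shows "avoid_prob (Suc r) q m \<le>
    exp (- ((1 - q) ^ N * exp (- (real (Suc r) * (real N * q) ^ r)) * coincidence_mean r q m))"
  using assms
proof (induction m rule: less_induct)
  case (less m)
  define \<delta> where "\<delta> = real (Suc r) * (real N * q) ^ r"
  define c where "c = (1 - q) ^ N * exp (- \<delta>)"
  define D where "D = 1 - (1 - q) ^ m"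
  define x where "x = c * coincidence_rate r q m"
  show ?case unfolding \<delta>_def[symmetric] c_def[symmetric]
  proof (cases "m = 0")
    case True
    then show "avoid_prob (Suc r) q m \<le> exp (- (c * coincidence_mean r q m))" by (simp add: avoid_prob_0)
  next
    case False
    then have m: "m \<ge> 1" by simp
    have D: "D > 0" unfolding D_def using q m by (intro one_minus_power_pos)
    have \<delta>: "0 \<le> \<delta>" using q by (simp add: \<delta>_def)
    have c: "0 \<le> c" using q by (simp add: c_def)
    have "c \<le> 1 * 1"
      unfolding c_def using q \<delta> by (intro mult_mono power_le_one) auto
    then have c1: "c \<le> 1" by simp
    have x0: "0 \<le> x" using q c by (simp add: x_def coincidence_rate_nonneg)
    have "x \<le> coincidence_rate r q m"
      unfolding x_def using c1 q by (simp add: mult_left_le_one_le c coincidence_rate_nonneg)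
    also have "\<dots> \<le> (real N * q) ^ r" using q less.prems by (intro coincidence_rate_le) auto
    finally have xN: "x \<le> (real N * q) ^ r" .
    define E where "E = exp (- (c * coincidence_mean r q m))"
    have bound: "avoid_prob (Suc r) q (m - i) \<le> E * (1 + real i * (x * exp \<delta>))"
      if i: "i \<in> {1..<Suc r}" for i
    proof -
      have "m - i < m" using i m by auto
      then have "avoid_prob (Suc r) q (m - i) \<le> exp (- (c * coincidence_mean r q (m - i)))"
        using less.IH[of "m - i"] less.prems by (simp add: c_def \<delta>_def)
      also have "\<dots> = E * exp (c * (coincidence_mean r q m - coincidence_mean r q (m - i)))"
        by (simp add: E_def exp_add[symmetric] algebra_simps)
      also have "\<dots> \<le> E * exp (real i * x)"
      proof -
        have "c * (coincidence_mean r q m - coincidence_mean r q (m - i)) \<le> c * (real i * coincidence_rate r q m)"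
          using q c by (intro mult_left_mono coincidence_mean_diff_le) auto
        then show ?thesis by (simp add: E_def x_def mult_ac)
      qed
      also have "exp (real i * x) \<le> 1 + real i * x * exp (real i * x)"
      proof -
        have "(1 - real i * x) * exp (real i * x) \<le> exp (- (real i * x)) * exp (real i * x)"
          using exp_ge_add_one_self[of "- (real i * x)"] by (intro mult_right_mono) auto
        then show ?thesis by (simp add: exp_minus algebra_simps)
      qed
      also have "\<dots> \<le> 1 + real i * x * exp \<delta>"
      proof -
        have "real i * x \<le> \<delta>"
          unfolding \<delta>_def using i xN x0 by (intro mult_mono) auto
        then show ?thesis using x0 by (intro add_left_mono mult_left_mono) auto
      qed
      finally show ?thesis by (simp add: E_def mult_ac)
    qed
    have "D * avoid_prob (Suc r) q m = (\<Sum>i\<in>{1..<Suc r}. Bernstein m i q * avoid_prob (Suc r) q (m - i))"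
      unfolding D_def by (intro avoid_prob_recursion q) simp
    also have "\<dots> \<le> (\<Sum>i\<in>{1..<Suc r}. Bernstein m i q * (E * (1 + real i * (x * exp \<delta>))))"
      using q by (intro sum_mono mult_left_mono bound) (auto simp: Bernstein_nonneg)
    also have "\<dots> = E * ((\<Sum>i\<in>{1..<Suc r}. Bernstein m i q) +
        (x * exp \<delta>) * (\<Sum>i\<in>{1..<Suc r}. real i * Bernstein m i q))"
      by (simp only: sum_distrib_left sum.distrib[symmetric]) (intro sum.cong, auto simp: algebra_simps)
    also have "(\<Sum>i\<in>{1..<Suc r}. Bernstein m i q) = D - binomial_tail q (Suc r) m"
      unfolding D_def by (intro sum_Bernstein_pos q) simp
    also have "E * (D - binomial_tail q (Suc r) m +
        (x * exp \<delta>) * (\<Sum>i\<in>{1..<Suc r}. real i * Bernstein m i q)) \<le> E * D"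
    proof -
      have "(x * exp \<delta>) * (\<Sum>i\<in>{1..<Suc r}. real i * Bernstein m i q) \<le> (x * exp \<delta>) * (real m * q)"
        using x0 by (intro mult_left_mono sum_index_Bernstein_le q) auto
      also have "\<dots> = real m * q * coincidence_rate r q m * (1 - q) ^ N"
        by (simp add: x_def c_def exp_minus)
      also have "\<dots> \<le> real m * q * coincidence_rate r q m * (1 - q) ^ (m - Suc r)"
        using q less.prems by (intro mult_left_mono power_decreasing) (auto simp: coincidence_rate_nonneg)
      also have "\<dots> = Bernstein m (Suc r) q"
        by (simp only: Bernstein_def choose_eq_coincidence_rate[OF m, symmetric])
      also have "\<dots> \<le> binomial_tail q (Suc r) m"
        by (intro Bernstein_le_binomial_tail q)
      finally show ?thesis by (simp add: E_def)
    qed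
    finally have "D * avoid_prob (Suc r) q m \<le> D * E" by (simp add: mult.commute)
    with D show "avoid_prob (Suc r) q m \<le> exp (- (c * coincidence_mean r q m))" by (simp add: E_def)
  qed
qed

section \<open>Decay when many terms coincide\<close>

text \<open>
  By the block bound the hazard rate with \<open>k * M'\<close> terms left is at least
  \<open>t ^ k / (k * t) = t ^ (k - 1) / k\<close>, where \<open>t = 1 - (1 - q) ^ M'\<close>, and a nonempty level uses up fewer
  than \<open>k\<close> terms. Starting from \<open>k * (M + s)\<close> terms, there are thus \<open>s\<close> chances to fail before only
  \<open>k * M\<close> terms remain.
\<close>
lemma avoid_prob_blocks_le:
  assumes M: "M \<ge> 1"
  shows "avoid_prob (Suc r) q (Suc r * (M + s)) \<le> (1 - (1 - (1 - q) ^ M) ^ r / real (Suc r)) ^ s"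
proof (induction s)
  case 0
  show ?case by (simp add: avoid_prob_le_1)
next
  case (Suc s)
  define t where "t = (\<lambda>m. 1 - (1 - q) ^ m)"
  define M' where "M' = M + Suc s"
  define n where "n = Suc r * M'"
  define \<rho> where "\<rho> = t M ^ r / real (Suc r)"
  have t: "0 < t m" if "m \<ge> 1" for m
    unfolding t_def using q that by (intro one_minus_power_pos)
  have tM: "t M \<le> t M'"
    unfolding t_def M'_def using q by (intro diff_left_mono power_decreasing) auto
  have t0: "0 \<le> t M" "t M \<le> 1" using t[OF M] q by (auto simp: t_def)
  have n: "n \<ge> 1" by (simp add: n_def M'_def)
  \<comment> \<open>A union bound over \<open>k\<close> blocks of length \<open>M'\<close>, in the form of Bernoulli's inequality.\<close>
  have union: "t n \<le> real (Suc r) * t M'"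
  proof -
    have "1 + real (Suc r) * ((1 - q) ^ M' - 1) \<le> (1 + ((1 - q) ^ M' - 1)) ^ Suc r"
      using q by (intro Bernoulli_inequality) simp
    also have "\<dots> = (1 - q) ^ n"
      by (simp add: n_def power_mult[symmetric] mult.commute del: power_Suc mult_Suc)
    finally show ?thesis by (simp add: t_def algebra_simps)
  qed
  have "\<rho> * t n \<le> \<rho> * (real (Suc r) * t M')"
    using union t0 by (intro mult_left_mono) (auto simp: \<rho>_def)
  also have "\<dots> = t M ^ r * t M'" by (simp add: \<rho>_def)
  also have "\<dots> \<le> t M' ^ r * t M'"
    using tM t0 by (intro mult_right_mono power_mono) auto
  also have "\<dots> = binomial_tail q 1 M' ^ Suc r"
    by (simp add: t_def binomial_tail_one)
  also have "\<dots> \<le> binomial_tail q (Suc r) n"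
    unfolding n_def by (rule binomial_tail_blocks[OF q])
  finally have tail: "\<rho> * t n \<le> binomial_tail q (Suc r) n" .
  have "t M ^ r \<le> 1" using t0 by (simp add: power_le_one)
  then have \<rho>: "\<rho> \<le> 1" by (simp add: \<rho>_def divide_le_eq)
  have "t n * avoid_prob (Suc r) q n \<le> (t n - binomial_tail q (Suc r) n) * avoid_prob (Suc r) q (n - Suc r)"
    unfolding t_def by (intro avoid_prob_le_earlier q) simp
  also have "\<dots> \<le> (t n - \<rho> * t n) * avoid_prob (Suc r) q (n - Suc r)"
    using tail by (intro mult_right_mono avoid_prob_nonneg) auto
  also have "n - Suc r = Suc r * (M + s)" by (simp add: n_def M'_def)
  finally have "t n * avoid_prob (Suc r) q n \<le> t n * ((1 - \<rho>) * avoid_prob (Suc r) q (Suc r * (M + s)))"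
    by (simp only: algebra_simps)
  then have "avoid_prob (Suc r) q n \<le> (1 - \<rho>) * avoid_prob (Suc r) q (Suc r * (M + s))"
    using t[OF n] by simp
  also have "\<dots> \<le> (1 - \<rho>) * (1 - \<rho>) ^ s"
    using Suc \<rho> unfolding \<rho>_def t_def by (intro mult_left_mono) auto
  finally show ?case by (simp add: n_def M'_def \<rho>_def t_def)
qed

text \<open>
  The case \<open>s = M\<close> of the previous bound, with \<open>M\<close> about \<open>N / (2 k)\<close>. Since \<open>y \<le> M\<close>, the exponent
  is at least \<open>y * (y q / (1 + y q)) ^ r / k\<close>, and the minimum separates the cases \<open>y q \<ge> 1\<close> and
  \<open>y q \<le> 1\<close>. The first case includes the sequences \<open>q\<close> that stay away from 0.
\<close>
lemma avoid_prob_le_exp_min: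
  assumes N: "N \<ge> 2 * Suc r" and y: "y = real N / (4 * real (Suc r))"
  shows "avoid_prob (Suc r) q N \<le> exp (- (min y (y ^ Suc r * q ^ r) / (2 ^ r * real (Suc r))))"
proof -
  define M where "M = N div (2 * Suc r)"
  define \<rho> where "\<rho> = (1 - (1 - q) ^ M) ^ r / real (Suc r)"
  have M: "M \<ge> 1" using N by (simp add: M_def Suc_le_eq div_greater_zero_iff)
  have "N < 2 * Suc r * Suc M" unfolding M_def using dividend_less_div_times[of "2 * Suc r" N]
    by (simp add: algebra_simps)
  also have "\<dots> \<le> 2 * Suc r * (2 * M)" using M by (intro mult_left_mono) auto
  finally have "real N \<le> real (2 * Suc r * (2 * M))" by linarith
  then have yM: "y \<le> real M" by (simp add: y field_simps)
  have y0: "0 < y" using N by (simp add: y)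
  have "Suc r * (M + M) \<le> N"
    unfolding M_def using div_times_less_eq_dividend[of N "2 * Suc r"] by (simp add: algebra_simps)
  then have "avoid_prob (Suc r) q N \<le> avoid_prob (Suc r) q (Suc r * (M + M))"
    by (rule avoid_prob_antimono)
  also have "\<dots> \<le> (1 - \<rho>) ^ M"
    unfolding \<rho>_def by (rule avoid_prob_blocks_le[OF M])
  also have "\<dots> \<le> exp (- \<rho>) ^ M"
  proof (rule power_mono)
    show "1 - \<rho> \<le> exp (- \<rho>)" using exp_ge_add_one_self[of "- \<rho>"] by simp
    have "(1 - (1 - q) ^ M) ^ r \<le> 1" using q by (intro power_le_one) (auto simp: power_le_one)
    then show "0 \<le> 1 - \<rho>" by (simp add: \<rho>_def divide_le_eq)
  qed
  also have "\<dots> = exp (- (real M * \<rho>))" by (simp add: exp_of_nat_mult[symmetric])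
  also have "\<dots> \<le> exp (- (min y (y ^ Suc r * q ^ r) / (2 ^ r * real (Suc r))))"
  proof -
    define z where "z = y * q"
    have z: "0 < z" using y0 q by (simp add: z_def)
    have zM: "z \<le> real M * q" using yM q by (simp add: z_def)
    \<comment> \<open>The map \<open>z \<mapsto> z / (1 + z)\<close> is increasing and comparable to \<open>min 1 z\<close>.\<close>
    have "min 1 z / 2 \<le> z / (1 + z)"
      using z by (auto simp: min_def field_simps)
    also have "\<dots> \<le> real M * q / (1 + real M * q)"
      using z zM by (simp add: field_simps)
    also have "\<dots> \<le> 1 - (1 - q) ^ M" by (rule binomial_tail_one_ge[OF q])
    finally have "(min 1 z / 2) ^ r \<le> (1 - (1 - q) ^ M) ^ r"
      using z by (intro power_mono) auto
    then have "y * ((min 1 z / 2) ^ r / real (Suc r)) \<le> real M * \<rho>"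
      unfolding \<rho>_def using yM y0 z by (intro mult_mono divide_right_mono) auto
    moreover have "y * ((min 1 z / 2) ^ r / real (Suc r)) = y * min 1 z ^ r / (2 ^ r * real (Suc r))"
      by (simp add: power_divide)
    moreover have "y * min 1 z ^ r \<ge> min y (y ^ Suc r * q ^ r)"
      using y0 by (auto simp: min_def z_def power_mult_distrib mult_ac)
    ultimately show ?thesis
      by (smt (verit) divide_right_mono exp_le_cancel_iff of_nat_0_le_iff zero_le_mult_iff zero_le_power)
  qed
  finally show ?thesis .
qed

end

section \<open>Limits\<close>

lemma binomial_over_power_tendsto:
  "(\<lambda>n. real (n choose k) / real n ^ k) \<longlonglongrightarrow> 1 / fact k"
proof (induction k)
  case 0
  show ?case by simp
next
  case (Suc k)
  have "(\<lambda>n. (1 - real k / real n) / real (Suc k)) \<longlonglongrightarrow> (1 - 0) / real (Suc k)"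
    by (intro tendsto_intros lim_const_over_n) simp
  then have "(\<lambda>n. real (n choose k) / real n ^ k * ((1 - real k / real n) / real (Suc k)))
      \<longlonglongrightarrow> 1 / fact k * ((1 - 0) / real (Suc k))"
    by (intro tendsto_mult Suc.IH)
  also have "1 / fact k * ((1 - 0) / real (Suc k)) = 1 / fact (Suc k)"
    by (simp add: mult.commute)
  finally show ?case
  proof (rule Lim_transform_eventually)
    show "\<forall>\<^sub>F n in sequentially. real (n choose k) / real n ^ k * ((1 - real k / real n) / real (Suc k)) =
        real (n choose Suc k) / real n ^ Suc k"
      using eventually_ge_at_top[of "Suc k"]
    proof eventually_elim
      case (elim n)
      have "real (Suc k) * real (n choose Suc k) = real (n choose k) * (real n - real k)"
        using binomial_absorb_comp[of n k] elim
        by (metis Suc_leD binomial_absorption of_nat_diff of_nat_mult mult.commute)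
      then have "real (n choose Suc k) = real (n choose k) * (real n - real k) / real (Suc k)"
        by (simp add: field_simps)
      then show ?case using elim by (simp add: diff_divide_distrib right_diff_distrib mult_ac)
    qed
  qed
qed

lemma avoid_prob_tendsto_0:
  fixes q :: "nat \<Rightarrow> real"
  assumes q: "\<And>n. 0 < q n" "\<And>n. q n \<le> 1"
    and W: "filterlim (\<lambda>n. real n ^ Suc r * q n ^ r) at_top sequentially"
  shows "(\<lambda>n. avoid_prob (Suc r) (q n) n) \<longlonglongrightarrow> 0"
proof -
  define y where "y = (\<lambda>n. real n / (4 * real (Suc r)))"
  define a where "a = 1 / (2 ^ r * real (Suc r))"
  have a: "a > 0" by (simp add: a_def)
  have Y: "filterlim y at_top sequentially"
    unfolding y_def divide_inverse
    by (intro filterlim_at_top_mult_tendsto_pos[OF tendsto_const _ filterlim_real_sequentially]) simp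
  have "filterlim (\<lambda>n. real n ^ Suc r * q n ^ r * (1 / (4 * real (Suc r)) ^ Suc r)) at_top sequentially"
    by (intro filterlim_at_top_mult_tendsto_pos[OF tendsto_const _ W]) simp
  then have YW: "filterlim (\<lambda>n. y n ^ Suc r * q n ^ r) at_top sequentially"
    by (simp add: y_def power_divide mult_ac)
  have "filterlim (\<lambda>n. min (y n) (y n ^ Suc r * q n ^ r)) at_top sequentially"
    unfolding filterlim_at_top
  proof
    fix Z
    show "\<forall>\<^sub>F n in sequentially. Z \<le> min (y n) (y n ^ Suc r * q n ^ r)"
      using Y[unfolded filterlim_at_top, rule_format, of Z]
        YW[unfolded filterlim_at_top, rule_format, of Z]
      by eventually_elim simp
  qed
  then have "filterlim (\<lambda>n. min (y n) (y n ^ Suc r * q n ^ r) * a) at_top sequentially"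
    by (rule filterlim_at_top_mult_tendsto_pos[OF tendsto_const a])
  then have "((\<lambda>n. exp (- (min (y n) (y n ^ Suc r * q n ^ r) * a))) \<longlongrightarrow> 0) sequentially"
    by (intro filterlim_compose[OF exp_at_bot] filterlim_compose[OF filterlim_uminus_at_bot_at_top])
  moreover have "\<forall>\<^sub>F n in sequentially. norm (avoid_prob (Suc r) (q n) n) \<le>
      exp (- (min (y n) (y n ^ Suc r * q n ^ r) * a))"
    using eventually_ge_at_top[of "2 * Suc r"]
  proof eventually_elim
    case (elim n)
    show ?case using avoid_prob_le_exp_min[OF q(1) q(2) elim refl] 
      by (simp add: y_def a_def avoid_prob_nonneg)
  qed
  ultimately show ?thesis by (rule Lim_null_comparison[rotated])
qed

text \<open>
  If \<open>n ^ (r + 1) * q ^ r\<close> converges then \<open>(n * q) ^ r\<close> is of order \<open>1 / n\<close>. Hence \<open>n * q\<close> tends to 0, and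
  with it all error terms in the two exponential bounds.
\<close>
lemma avoid_prob_tendsto_exp:
  fixes q :: "nat \<Rightarrow> real"
  assumes q: "\<And>n. 0 < q n" "\<And>n. q n \<le> 1" and r: "r \<ge> 1"
    and W: "(\<lambda>n. real n ^ Suc r * q n ^ r) \<longlonglongrightarrow> \<beta>"
  shows "(\<lambda>n. avoid_prob (Suc r) (q n) n) \<longlonglongrightarrow> exp (- (\<beta> / (real (Suc r) * fact (Suc r))))"
proof -
  define u where "u = (\<lambda>n. real n * q n)"
  have ur: "(\<lambda>n. u n ^ r) \<longlonglongrightarrow> 0"
  proof -
    have "(\<lambda>n. real n ^ Suc r * q n ^ r * (1 / real n)) \<longlonglongrightarrow> \<beta> * 0"
      by (intro tendsto_mult W lim_const_over_n)
    then have "(\<lambda>n. real n ^ Suc r * q n ^ r * (1 / real n)) \<longlonglongrightarrow> 0" by simp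
    then show ?thesis
      by (rule Lim_transform_eventually)
        (use eventually_gt_at_top[of 0] in \<open>eventually_elim, simp add: u_def power_mult_distrib\<close>)
  qed
  have u0: "0 \<le> u n" for n using q(1)[of n] by (simp add: u_def)
  have "(\<lambda>n. root r (u n ^ r)) \<longlonglongrightarrow> root r 0" by (intro tendsto_real_root ur)
  then have u: "u \<longlonglongrightarrow> 0" using r u0 by (simp add: real_root_power_cancel)
  have pow: "(\<lambda>n. (1 - q n) ^ n) \<longlonglongrightarrow> 1"
  proof (rule tendsto_sandwich)
    have "1 - u n \<le> (1 - q n) ^ n" for n
      using Bernoulli_inequality[of "- q n" n] q(2)[of n] by (simp add: u_def)
    then show "\<forall>\<^sub>F n in sequentially. 1 - u n \<le> (1 - q n) ^ n" by simp
    show "\<forall>\<^sub>F n in sequentially. (1 - q n) ^ n \<le> 1"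
      using q by (intro always_eventually allI power_le_one) (auto intro: less_imp_le)
    show "(\<lambda>n. 1 - u n) \<longlonglongrightarrow> 1" using tendsto_diff[OF tendsto_const[of 1] u] by simp
  qed simp
  define L where "L = (\<lambda>n. coincidence_mean r (q n) n)"
  define \<mu> where "\<mu> = \<beta> / (real (Suc r) * fact (Suc r))"
  have L: "L \<longlonglongrightarrow> \<mu>"
  proof -
    have "(\<lambda>n. real (n choose Suc r) / real n ^ Suc r * (real n ^ Suc r * q n ^ r) / real (Suc r))
        \<longlonglongrightarrow> 1 / fact (Suc r) * \<beta> / real (Suc r)"
      by (intro tendsto_divide tendsto_mult binomial_over_power_tendsto W tendsto_const) simp
    also have "1 / fact (Suc r) * \<beta> / real (Suc r) = \<mu>" by (simp add: \<mu>_def)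
    finally show ?thesis
      by (rule Lim_transform_eventually)
        (use eventually_gt_at_top[of 0] in \<open>eventually_elim, simp add: L_def coincidence_mean_def\<close>)
  qed
  define \<epsilon> where "\<epsilon> = (\<lambda>n. u n ^ r * (1 + u n))"
  have \<epsilon>: "\<epsilon> \<longlonglongrightarrow> 0"
    unfolding \<epsilon>_def using tendsto_mult[OF ur tendsto_add[OF tendsto_const[of 1] u]] by simp
  show ?thesis unfolding \<mu>_def[symmetric]
  proof (rule tendsto_sandwich)
    show "(\<lambda>n. exp (- ((1 + u n) / (1 - \<epsilon> n) * L n))) \<longlonglongrightarrow> exp (- \<mu>)"
    proof -
      have "(\<lambda>n. exp (- ((1 + u n) / (1 - \<epsilon> n) * L n))) \<longlonglongrightarrow> exp (- ((1 + 0) / (1 - 0) * \<mu>))"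
        by (intro tendsto_intros u \<epsilon> L) simp
      then show ?thesis by simp
    qed
    show "(\<lambda>n. exp (- ((1 - q n) ^ n * exp (- (real (Suc r) * u n ^ r)) * L n))) \<longlonglongrightarrow> exp (- \<mu>)"
    proof -
      have "(\<lambda>n. exp (- ((1 - q n) ^ n * exp (- (real (Suc r) * u n ^ r)) * L n)))
          \<longlonglongrightarrow> exp (- (1 * exp (- (real (Suc r) * 0)) * \<mu>))"
        by (intro tendsto_exp tendsto_minus tendsto_mult pow ur L tendsto_const)
      then show ?thesis by simp
    qed
    show "\<forall>\<^sub>F n in sequentially. exp (- ((1 + u n) / (1 - \<epsilon> n) * L n)) \<le> avoid_prob (Suc r) (q n) n"
      using order_tendstoD(2)[OF \<epsilon> zero_less_one]
    proof eventually_elim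
      case (elim n)
      show ?case
        using exp_coincidence_mean_le_avoid_prob[OF q(1) q(2), where N = n and m = n and r = r and \<epsilon> = "\<epsilon> n"] elim
        by (simp add: u_def L_def \<epsilon>_def)
    qed
    show "\<forall>\<^sub>F n in sequentially. avoid_prob (Suc r) (q n) n \<le>
        exp (- ((1 - q n) ^ n * exp (- (real (Suc r) * u n ^ r)) * L n))"
      unfolding u_def L_def using q by (intro always_eventually allI avoid_prob_le_exp_coincidence_mean) auto
  qed
qed

text \<open>
  With \<open>r = k - 1\<close>, the \<open>r\<close>-th power of \<open>q n / threshold n\<close> is \<open>n ^ (r + 1) * q n ^ r\<close>, so that the three
  regimes say that this quantity diverges, tends to \<open>\<alpha> ^ r\<close>, or tends to 0.
\<close>
theorem proposition4p27:
  fixes k :: nat and \<alpha> :: real and p q :: "nat \<Rightarrow> real"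
  assumes "k \<ge> 2" and "\<alpha> > 0"
    and "\<And>n. 0 \<le> p n \<and> p n < 1"
    and "\<And>n. q n = 1 - p n"
  defines "threshold \<equiv> \<lambda>n::nat. real n powr (- (real k / (real k - 1)))"
    and "P \<equiv> \<lambda>n. measure_pmf.prob (geometric_composition n (p n)) {C. has_equal_terms n k C}"
  shows "(much_less threshold q \<longrightarrow> P \<longlonglongrightarrow> 1)
       \<and> (asymptotic_to q (\<lambda>n. \<alpha> * threshold n) \<longrightarrow>
            P \<longlonglongrightarrow> 1 - exp (- (\<alpha> ^ (k - 1) / (real k * fact k))))
       \<and> (much_less q threshold \<longrightarrow> P \<longlonglongrightarrow> 0)"
proof -
  define r where "r = k - 1"
  have k: "k = Suc r" and r: "r \<ge> 1" using assms(1) by (auto simp: r_def)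
  have q: "0 < q n" "q n \<le> 1" for n using assms(3)[of n] assms(4)[of n] by auto
  define W where "W = (\<lambda>n. real n ^ Suc r * q n ^ r)"
  have P: "P n = 1 - avoid_prob (Suc r) (q n) n" for n
  proof -
    have "P n = measure_pmf.prob (geometric_composition n (p n))
        (UNIV - {C. levels_below k {1..n} C})"
      unfolding P_def using has_equal_terms_iff[of k n] assms(1)
      by (intro arg_cong[where f = "measure_pmf.prob _"]) auto
    also have "\<dots> = 1 - avoid_prob k (q n) n"
      by (simp add: measure_pmf.prob_compl[simplified] avoid_prob_def avoid_prob_on_def geometric_composition_def assms(4))
    finally show ?thesis by (simp add: k)
  qed
  have thr: "threshold n ^ r = inverse (real n ^ Suc r)" for n
  proof (cases "n = 0")
    case True
    then show ?thesis using r by (simp add: threshold_def power_0_left)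
  next
    case False
    have "threshold n ^ r = real n powr (- (real k / (real k - 1)) * real r)"
      unfolding threshold_def using False by (simp add: powr_power mult.commute)
    also have "- (real k / (real k - 1)) * real r = - real (Suc r)"
      using r by (simp add: k)
    also have "real n powr - real (Suc r) = inverse (real n ^ Suc r)"
      unfolding powr_minus using False by (subst powr_realpow) auto
    finally show ?thesis .
  qed
  have ratio: "(q n / threshold n) ^ r = W n" for n
    by (simp only: power_divide thr W_def) (simp add: divide_inverse mult.commute)
  have sup: "P \<longlonglongrightarrow> 1" if "much_less threshold q"
  proof -
    have "(\<lambda>n. (threshold n / q n) ^ r) \<longlonglongrightarrow> 0 ^ r"
      using that unfolding much_less_def by (rule tendsto_power)
    then have "(\<lambda>n. (threshold n / q n) ^ r) \<longlonglongrightarrow> 0" using r by (simp add: power_0_left)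
    moreover have "(threshold n / q n) ^ r = inverse (W n)" for n
      unfolding ratio[symmetric] by (simp add: power_divide)
    ultimately have "(\<lambda>n. inverse (W n)) \<longlonglongrightarrow> 0" by simp
    moreover have "\<forall>\<^sub>F n in sequentially. 0 < inverse (W n)"
      using eventually_gt_at_top[of 0] by eventually_elim (simp add: W_def q)
    ultimately have "filterlim (\<lambda>n. inverse (inverse (W n))) at_top sequentially"
      by (rule filterlim_inverse_at_top)
    then have "(\<lambda>n. avoid_prob (Suc r) (q n) n) \<longlonglongrightarrow> 0"
      using avoid_prob_tendsto_0[OF q(1) q(2)] by (simp add: W_def)
    then have "(\<lambda>n. 1 - avoid_prob (Suc r) (q n) n) \<longlonglongrightarrow> 1 - 0" by (intro tendsto_intros)
    then show ?thesis by (simp add: P[abs_def])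
  qed
  have lim: "P \<longlonglongrightarrow> 1 - exp (- (\<beta> / (real k * fact k)))" if "W \<longlonglongrightarrow> \<beta>" for \<beta>
    unfolding P[abs_def] k
    by (intro tendsto_diff tendsto_const avoid_prob_tendsto_exp q r that[unfolded W_def])
  have crit: "P \<longlonglongrightarrow> 1 - exp (- (\<alpha> ^ (k - 1) / (real k * fact k)))"
    if "asymptotic_to q (\<lambda>n. \<alpha> * threshold n)"
  proof -
    have "(\<lambda>n. \<alpha> ^ r * (q n / (\<alpha> * threshold n)) ^ r) \<longlonglongrightarrow> \<alpha> ^ r * 1 ^ r"
      using that unfolding asymptotic_to_def by (intro tendsto_mult tendsto_const tendsto_power)
    moreover have "\<alpha> ^ r * (q n / (\<alpha> * threshold n)) ^ r = W n" for n
      unfolding ratio[symmetric] using assms(2) by (simp add: power_divide power_mult_distrib)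
    ultimately have "W \<longlonglongrightarrow> \<alpha> ^ (k - 1)" by (simp add: k)
    then show ?thesis by (rule lim)
  qed
  have sub: "P \<longlonglongrightarrow> 0" if "much_less q threshold"
  proof -
    have "(\<lambda>n. (q n / threshold n) ^ r) \<longlonglongrightarrow> 0 ^ r"
      using that unfolding much_less_def by (rule tendsto_power)
    then have "W \<longlonglongrightarrow> 0" using r by (simp add: ratio power_0_left)
    then show ?thesis using lim[of 0] by simp
  qed
  from sup crit sub show ?thesis by blast
qed

end
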